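(* Let $N\ge 2$, let $A^{(N)}$ be a generator in a stable sandpile $\eta \in \Omega$ that has the form of an $N \times N$ square, and let $v_i \in R_1(A^{(N)})$. Then $$\mathbb{E}[X(\gamma_i \eta)\mid Y \in A^{(N)}] = \begin{cases} \dfrac{(N^2-1)(N^2+5N+6)}{10N}, &\text{if } N \text{ is odd}, \\[1.2em] \dfrac{N^5+5N^4+5N^3-5N^2-6N-30}{10N^2}, &\text{if } N \text{ is even.} \end{cases}$$
   Context: Fix an integer $L\ge 1$ and let $V=\{1,\ldots,L\}^2\subset\mathbb{Z}^2$, labelled $V=\{v_1,\ldots,v_{L^2}\}$. For $v,w\in V$ write $v\sim w$ if $v,w$ are nearest neighbours in $\mathbb{Z}^2$; connectedness of subsets of $V$ refers to this relation. All vertices of $\mathbb{Z}^2\setminus V$ are identified with a single sink; every $v\in V$ has four edges to its lattice neighbours, those leading outside $V$ going to the sink (grains sent there are discarded). A sandpile is a map $\eta:V\to\mathbb{Z}$. $\Omega$ is the set of stable sandpiles, i.e. those with $0\le\eta(v)<4$ for all $v\in V$. A vertex $v$ is critical in $\eta$ if $\eta(v)=3$. A generator in $\eta$ is a connected component (maximal connected set) of the set of critical vertices of $\eta$. The removal operator $\gamma_i$ sets $\eta(v_i)$ to $0$ and leaves all other values unchanged. Toppling a vertex $v\in V$ decreases $\eta(v)$ by $4$ and increases $\eta(w)$ by $1$ for each $w\in V$ with $w\sim v$; the toppling is legal if $\eta(v)>3$. Avalanche size: for $\eta\in\Omega$ and $v\in V$, $x(\eta,v)$ is the total number of topplings (counted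 with multiplicity) in any sequence of legal topplings that starts at the configuration obtained from $\eta$ by adding one grain at $v$ and ends at a stable configuration; this number is finite and independent of the sequence. $Y$ is uniformly distributed on $V$ (the vertex where the next grain lands) and $X(\eta)=x(\eta,Y)$, so for nonempty $B\subseteq V$, $\mathbb{E}[X(\eta)\mid Y\in B]=\frac{1}{|B|}\sum_{v\in B}x(\eta,v)$. Rings: for a square $B$ of side at least $3$, let $\delta^{\mathrm{in}}(B)$ (resp. $C(B)$) be the set of $v\in B$ having exactly one (resp. exactly two) nearest neighbours in $\mathbb{Z}^2$ outside $B$ (so $C(B)$ is the set of the four corners). For an $N\times N$ square $A$ with $N\ge3$ and $m=\lceil N/2\rceil$: $R_m(A)=\delta^{\mathrm{in}}(A)\cup C(A)$; for $j=m-1,\ldots,2$, $R_j(A)=\delta^{\mathrm{in}}(A_j)\cup C(A_j)$ with $A_j=A\setminus\bigcup_{k=j+1}^{m}R_k(A)$; and $R_1(A)=A\setminus\bigcup_{k=2}^{m}R_k(A)$. For $N\le 2$, $R_1(A)=A$. Thus $R_1(A)$ is the single central vertex if $N$ is odd and the central $2\times2$ block if $N$ is even. *)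

theory Defs
  imports "HOL-Probability.Probability"
begin

type_synonym vertex = "int \<times> int"

text \<open>A sandpile assigns an integer to every vertex of the box \<open>grid L\<close>. It is modelled as a total
  function; only its values on \<open>grid L\<close> are ever inspected, and topplings leave the other values
  untouched, so that grains leaving the box are discarded.\<close>

type_synonym sandpile = "vertex \<Rightarrow> int"

definition grid :: "nat \<Rightarrow> vertex set" where
  "grid L = {1..int L} \<times> {1..int L}"

definition nbr :: "vertex \<Rightarrow> vertex \<Rightarrow> bool" where
  "nbr v w \<longleftrightarrow> \<bar>fst v - fst w\<bar> + \<bar>snd v - snd w\<bar> = 1"

definition stable_sandpiles :: "nat \<Rightarrow> sandpile set" where
  "stable_sandpiles L = {\<eta>. \<forall>v\<in>grid L. 0 \<le> \<eta> v \<and> \<eta> v < 4}"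

definition critical :: "nat \<Rightarrow> sandpile \<Rightarrow> vertex set" where
  "critical L \<eta> = {v \<in> grid L. \<eta> v = 3}"

definition nbr_connected :: "vertex set \<Rightarrow> bool" where
  "nbr_connected S \<longleftrightarrow>
     S \<noteq> {} \<and> (\<forall>v\<in>S. \<forall>w\<in>S. (v, w) \<in> {(a, b). a \<in> S \<and> b \<in> S \<and> nbr a b}\<^sup>*)"

definition generator :: "nat \<Rightarrow> sandpile \<Rightarrow> vertex set \<Rightarrow> bool" where
  "generator L \<eta> A \<longleftrightarrow>
     nbr_connected A \<and> A \<subseteq> critical L \<eta> \<and>
     (\<forall>B. nbr_connected B \<and> B \<subseteq> critical L \<eta> \<and> A \<subseteq> B \<longrightarrow> B = A)"

definition square_of_side :: "nat \<Rightarrow> vertex set \<Rightarrow> bool" where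
  "square_of_side N A \<longleftrightarrow> (\<exists>a b. A = {a..<a + int N} \<times> {b..<b + int N})"

definition remove_grains :: "vertex \<Rightarrow> sandpile \<Rightarrow> sandpile" where
  "remove_grains v \<eta> = \<eta>(v := 0)"

definition add_grain :: "vertex \<Rightarrow> sandpile \<Rightarrow> sandpile" where
  "add_grain v \<eta> = \<eta>(v := \<eta> v + 1)"

definition topple :: "nat \<Rightarrow> vertex \<Rightarrow> sandpile \<Rightarrow> sandpile" where
  "topple L v \<eta> =
     (\<lambda>w. if w = v then \<eta> w - 4 else if w \<in> grid L \<and> nbr w v then \<eta> w + 1 else \<eta> w)"

inductive legal_topplings :: "nat \<Rightarrow> sandpile \<Rightarrow> vertex list \<Rightarrow> sandpile \<Rightarrow> bool" for L where
  Nil: "legal_topplings L \<eta> [] \<eta>"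
| Cons: "v \<in> grid L \<Longrightarrow> \<eta> v > 3 \<Longrightarrow> legal_topplings L (topple L v \<eta>) vs \<zeta> \<Longrightarrow>
         legal_topplings L \<eta> (v # vs) \<zeta>"

text \<open>The common length of all stabilizing sequences of legal topplings. That there is exactly
  one such number, for stable \<open>\<eta>\<close> and \<open>v \<in> grid L\<close>, is a standard fact, which is not built into the
  definition.\<close>

definition avalanche_size :: "nat \<Rightarrow> sandpile \<Rightarrow> vertex \<Rightarrow> nat" where
  "avalanche_size L \<eta> v =
     (THE n. \<exists>vs \<zeta>. legal_topplings L (add_grain v \<eta>) vs \<zeta> \<and> \<zeta> \<in> stable_sandpiles L \<and>
                     length vs = n)"

text \<open>The probability space is \<open>grid L\<close> with the uniform distribution, and \<open>Y\<close> is the identity on it: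
  the conditional expectation of \<open>X(\<eta>) = x(\<eta>, Y)\<close> given \<open>Y \<in> B\<close>.\<close>

definition expected_avalanche :: "nat \<Rightarrow> sandpile \<Rightarrow> vertex set \<Rightarrow> real" where
  "expected_avalanche L \<eta> B =
     measure_pmf.expectation (cond_pmf (pmf_of_set (grid L)) B) (\<lambda>Y. real (avalanche_size L \<eta> Y))"

lemma expected_avalanche_eq_average:
  assumes "B \<subseteq> grid L" "B \<noteq> {}"
  shows "expected_avalanche L \<eta> B = (\<Sum>v\<in>B. real (avalanche_size L \<eta> v)) / real (card B)"
proof -
  have fin: "finite (grid L)" by (simp add: grid_def)
  then have finB: "finite B" using assms(1) finite_subset by blast
  have ne: "grid L \<noteq> {}" and inter: "grid L \<inter> B = B" using assms by auto
  have "cond_pmf (pmf_of_set (grid L)) B = pmf_of_set B"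
  proof (rule pmf_eqI)
    fix v
    show "pmf (cond_pmf (pmf_of_set (grid L)) B) v = pmf (pmf_of_set B) v"
      using fin finB ne inter assms
      by (subst pmf_cond) (auto simp: measure_pmf_of_set indicator_def card_gt_0_iff)
  qed
  then show ?thesis
    using finB assms(2) by (simp add: expected_avalanche_def integral_pmf_of_set)
qed

definition outside_nbrs :: "vertex set \<Rightarrow> vertex \<Rightarrow> vertex set" where
  "outside_nbrs B v = {w. nbr v w \<and> w \<notin> B}"

definition inner_boundary :: "vertex set \<Rightarrow> vertex set" where
  "inner_boundary B = {v \<in> B. card (outside_nbrs B v) = 1}"

definition corners :: "vertex set \<Rightarrow> vertex set" where
  "corners B = {v \<in> B. card (outside_nbrs B v) = 2}"

text \<open>\<open>square_ring N A j\<close> is \<open>R\<^sub>j(A)\<close> for an \<open>N \<times> N\<close> square \<open>A\<close> and \<open>1 \<le> j \<le> \<lceil>N/2\<rceil>\<close>; for \<open>j = \<lceil>N/2\<rceil>\<close> the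
  union is empty, so that the set \<open>A\<^sub>j\<close> is \<open>A\<close> itself.\<close>

function square_ring :: "nat \<Rightarrow> vertex set \<Rightarrow> nat \<Rightarrow> vertex set" where
  "square_ring N A j =
     (let A\<^sub>j = A - (\<Union>k\<in>{j + 1..nat \<lceil>real N / 2\<rceil>}. square_ring N A k)
      in if j \<le> 1 then A\<^sub>j else inner_boundary A\<^sub>j \<union> corners A\<^sub>j)"
  by pat_completeness auto
termination
  by (relation "Wellfounded.measure (\<lambda>(N, A, j). nat \<lceil>real N / 2\<rceil> - j)") auto

declare square_ring.simps [simp del]

end

theory Submission
  imports Defs
begin

text \<open>
  An avalanche started at \<open>y\<close> in a square generator proceeds in waves: the first topples the whole
  square once, the second the concentric square with side smaller by 2, and so on, until the current
  square has \<open>y\<close> on its boundary. So \<open>w\<close> topples \<open>min (d w) (d y)\<close> times, where \<open>d\<close> is the depth in the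
  square. Emptying a vertex \<open>v\<close> of the innermost ring changes little. As long as all four neighbours of
  \<open>v\<close> topple in a wave, \<open>v\<close> receives four grains and topples too. Only a wave on the
  central \<open>2 \<times> 2\<close> block, which exists for even \<open>N\<close>, omits \<open>v\<close>; and a grain added at \<open>v\<close> itself
  causes no avalanche.

  Instead of following the waves, the proof characterizes the toppling counts by the least action
  principle (\<open>least_action\<close>): they are the least nonnegative function \<open>u\<close> for which toppling each
  \<open>w\<close> exactly \<open>u w\<close> times, legally or not, leaves at most three grains everywhere
  (\<open>avalanche_size_eq_sum\<close>). That the function above has this property is a consequence of the
  superharmonicity of \<open>min (d w) D\<close>, a minimum of affine functions, together with the fact that the
  vertices bordering a generator are not critical (\<open>odometer_stabilizes\<close>). That it is the least one
  is shown wave by wave: one more toppling at \<open>y\<close> is forced and spreads through the punctured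
  square (\<open>next_wave\<close>, \<open>punctured_rectangle_spread\<close>).

  Since \<open>min (d w) (d y)\<close> counts the concentric squares that contain both \<open>w\<close> and \<open>y\<close>, its sum over
  all pairs is the sum of the fourth powers of the sides \<open>N, N - 2, \<dots>\<close>. Subtracting the sum of
  the squares of these sides for the start \<open>y = v\<close>, and 3 for the omitted topplings at \<open>v\<close> if \<open>N\<close> is
  even, gives the total avalanche size (\<open>sum_avalanche_sizes\<close>); dividing by \<open>N\<^sup>2\<close> gives the claim.
\<close>

section \<open>Odometers and the least action principle\<close>

definition nbr_sum :: "(vertex \<Rightarrow> int) \<Rightarrow> vertex \<Rightarrow> int" where
  "nbr_sum u w = u (fst w + 1, snd w) + u (fst w - 1, snd w)
               + u (fst w, snd w + 1) + u (fst w, snd w - 1)"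

text \<open>The number \<open>u w\<close> says how often \<open>w\<close> is toppled, legally or not; the second conjunct bounds the
  resulting number of grains, because topplings commute.\<close>
definition stabilizes :: "nat \<Rightarrow> sandpile \<Rightarrow> (vertex \<Rightarrow> int) \<Rightarrow> bool" where
  "stabilizes L \<eta> u \<longleftrightarrow>
     (\<forall>w. 0 \<le> u w) \<and> (\<forall>w\<in>grid L. \<eta> w - 4 * u w + nbr_sum u w \<le> 3)"

lemma finite_grid [simp]: "finite (grid L)"
  by (simp add: grid_def)

lemma nbr_sum_nonneg: "(\<And>w. 0 \<le> u w) \<Longrightarrow> 0 \<le> nbr_sum u w"
  by (simp add: nbr_sum_def)

lemma nbr_sum_add: "nbr_sum (\<lambda>x. f x + g x) w = nbr_sum f w + nbr_sum g w"
  by (simp add: nbr_sum_def)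

lemma nbr_sum_diff: "nbr_sum (\<lambda>x. f x - g x) w = nbr_sum f w - nbr_sum g w"
  by (simp add: nbr_sum_def)

lemma nbr_sum_of_bool: "nbr_sum (\<lambda>x. of_bool (x = v)) w = of_bool (nbr w v)"
  by (cases v; cases w) (auto simp: nbr_sum_def nbr_def of_bool_def)

lemma not_nbr_self [simp]: "\<not> nbr v v"
  by (simp add: nbr_def)

lemma topple_eq:
  assumes "w \<in> grid L"
  shows "topple L v \<eta> w = \<eta> w - 4 * of_bool (w = v) + nbr_sum (\<lambda>x. of_bool (x = v)) w"
  using assms by (simp add: topple_def nbr_sum_of_bool)

lemma legal_topplings_value:
  assumes "legal_topplings L \<eta> vs \<zeta>" "w \<in> grid L"
  shows "\<zeta> w = \<eta> w - 4 * int (count_list vs w) + nbr_sum (\<lambda>x. int (count_list vs x)) w"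
  using assms
proof (induction rule: legal_topplings.induct)
  case (Cons v \<eta> vs \<zeta>)
  have "(\<lambda>x. int (count_list (v # vs) x)) = (\<lambda>x. int (count_list vs x) + of_bool (x = v))"
    by auto
  then show ?case
    using Cons by (simp add: topple_eq nbr_sum_add)
qed (simp add: nbr_sum_def)

lemma legal_topplings_in_grid:
  "legal_topplings L \<eta> vs \<zeta> \<Longrightarrow> set vs \<subseteq> grid L"
  by (induction rule: legal_topplings.induct) auto

lemma topple_nonneg:
  assumes "\<forall>w\<in>grid L. 0 \<le> \<eta> w" "3 < \<eta> v"
  shows "\<forall>w\<in>grid L. 0 \<le> topple L v \<eta> w"
  using assms by (force simp: topple_def)

text \<open>A vertex holding at least four grains can lose them only by toppling itself, since topplings
  elsewhere never take grains from it. Hence every stabilizing \<open>u\<close> topples it, and one of these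
  topplings can be performed first.\<close>
lemma stabilizes_topple:
  assumes u: "stabilizes L \<eta> u" and v: "v \<in> grid L" "3 < \<eta> v"
  shows "1 \<le> u v" and "stabilizes L (topple L v \<eta>) (\<lambda>x. u x - of_bool (x = v))"
proof -
  have nn: "\<And>w. 0 \<le> u w" using u unfolding stabilizes_def by blast
  have "\<eta> v - 4 * u v + nbr_sum u v \<le> 3" using u v by (simp add: stabilizes_def)
  then show 1: "1 \<le> u v" using nbr_sum_nonneg[of u v] nn v by simp
  show "stabilizes L (topple L v \<eta>) (\<lambda>x. u x - of_bool (x = v))"
    using u 1 by (auto simp: stabilizes_def topple_eq nbr_sum_diff algebra_simps of_bool_def)
qed

text \<open>The least action principle: each legal toppling is forced on every stabilizing \<open>u\<close>, so it
  can be charged against \<open>u\<close>.\<close>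
lemma least_action:
  assumes "legal_topplings L \<eta> vs \<zeta>" "stabilizes L \<eta> u"
  shows "int (count_list vs w) \<le> u w"
  using assms
proof (induction arbitrary: u rule: legal_topplings.induct)
  case (Nil \<eta>)
  then have "0 \<le> u w" unfolding stabilizes_def by blast
  then show ?case by simp
next
  case (Cons v \<eta> vs \<zeta>)
  have "int (count_list vs w) \<le> u w - of_bool (w = v)"
    using Cons.IH[OF stabilizes_topple(2)] Cons by simp
  then show ?case by (auto split: if_splits)
qed

text \<open>Legal topplings use up the budget \<open>u\<close>, so toppling greedily must terminate.\<close>
lemma legal_stabilization_exists:
  assumes "stabilizes L \<eta> u" "\<forall>w\<in>grid L. 0 \<le> \<eta> w"
  shows "\<exists>vs \<zeta>. legal_topplings L \<eta> vs \<zeta> \<and> \<zeta> \<in> stable_sandpiles L"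
  using assms
proof (induction "nat (\<Sum>w\<in>grid L. u w)" arbitrary: \<eta> u rule: less_induct)
  case less
  show ?case
  proof (cases "\<eta> \<in> stable_sandpiles L")
    case True
    then show ?thesis using legal_topplings.Nil by blast
  next
    case False
    then obtain v where v: "v \<in> grid L" "3 < \<eta> v"
      using less.prems(2) by (force simp: stable_sandpiles_def)
    let ?u = "\<lambda>x. u x - of_bool (x = v)"
    have "(\<Sum>w\<in>grid L. ?u w) = (\<Sum>w\<in>grid L. u w) - 1"
      using v(1) by (simp add: sum_subtractf of_bool_def)
    moreover have "0 \<le> ?u w" for w
      using stabilizes_topple(2)[OF less.prems(1) v] unfolding stabilizes_def by blast
    then have "0 \<le> (\<Sum>w\<in>grid L. ?u w)" by (intro sum_nonneg)
    ultimately have "nat (\<Sum>w\<in>grid L. ?u w) < nat (\<Sum>w\<in>grid L. u w)" by linarith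
    from less.hyps[OF this stabilizes_topple(2)[OF less.prems(1) v] topple_nonneg[OF less.prems(2) v(2)]]
    show ?thesis using legal_topplings.Cons[where \<eta> = \<eta>, OF v] by blast
  qed
qed

text \<open>The toppling counts of any legal stabilizing sequence stabilize, so they dominate the least
  stabilizing function; by the least action principle they are also dominated by it. Thus all such
  sequences have the same length, as the description in the definition of the avalanche size
  requires.\<close>
lemma avalanche_size_eq_sum:
  assumes nonneg: "\<forall>w\<in>grid L. 0 \<le> add_grain y \<eta> w"
    and u: "stabilizes L (add_grain y \<eta>) u"
    and least: "\<And>h w. stabilizes L (add_grain y \<eta>) h \<Longrightarrow> u w \<le> h w"
  shows "int (avalanche_size L \<eta> y) = (\<Sum>w\<in>grid L. u w)"
proof -
  have len: "int (length vs) = (\<Sum>w\<in>grid L. u w)"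
    if vs: "legal_topplings L (add_grain y \<eta>) vs \<zeta>" and \<zeta>: "\<zeta> \<in> stable_sandpiles L" for vs \<zeta>
  proof -
    have "stabilizes L (add_grain y \<eta>) (\<lambda>x. int (count_list vs x))"
      using legal_topplings_value[OF vs] \<zeta> by (force simp: stabilizes_def stable_sandpiles_def)
    then have "int (count_list vs w) = u w" for w
      using least least_action[OF vs u] by (metis antisym)
    then have "(\<Sum>w\<in>grid L. u w) = int (\<Sum>w\<in>grid L. count_list vs w)" by simp
    then show ?thesis
      using sum_count_set[OF legal_topplings_in_grid[OF vs]] by simp
  qed
  obtain vs \<zeta> where ex: "legal_topplings L (add_grain y \<eta>) vs \<zeta>" "\<zeta> \<in> stable_sandpiles L"
    using legal_stabilization_exists[OF u nonneg] by blast
  have "avalanche_size L \<eta> y = length vs"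
    unfolding avalanche_size_def
  proof (rule the_equality)
    show "\<exists>vs' \<zeta>. legal_topplings L (add_grain y \<eta>) vs' \<zeta> \<and> \<zeta> \<in> stable_sandpiles L \<and>
        length vs' = length vs" using ex by blast
  next
    fix n
    assume "\<exists>vs' \<zeta>. legal_topplings L (add_grain y \<eta>) vs' \<zeta> \<and> \<zeta> \<in> stable_sandpiles L \<and> length vs' = n"
    then show "n = length vs" using len ex by (metis of_nat_eq_iff)
  qed
  then show ?thesis using len ex by simp
qed

section \<open>Depth in a square\<close>

text \<open>The depth of a vertex in the \<open>n \<times> n\<close> square with lower left corner \<open>(a, b)\<close> is the index of
  the ring containing it, counted from the outermost one, which has index 1; it is nonpositive exactly
  outside the square. As a minimum of four affine functions it is concave.\<close>
definition depth :: "int \<Rightarrow> int \<Rightarrow> int \<Rightarrow> vertex \<Rightarrow> int" where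
  "depth a b n w =
     min (min (fst w - a + 1) (a + n - fst w)) (min (snd w - b + 1) (b + n - snd w))"

lemma depth_ge_iff:
  "k \<le> depth a b n w \<longleftrightarrow> w \<in> {a + k - 1..a + n - k} \<times> {b + k - 1..b + n - k}"
  by (cases w) (auto simp: depth_def)

text \<open>The part of superharmonicity that concerns one coordinate direction: \<open>p\<close> and \<open>q\<close> are the
  distances to the two sides met in this direction, \<open>e\<close> is the distance to the nearer of the other two
  sides. The inequality is strict on the ridge where the cutoff \<open>D\<close> is just reached, because the step
  towards the nearer side falls below the cutoff.\<close>
lemma truncated_min_concave:
  fixes p q e D :: int
  defines "f \<equiv> \<lambda>x. max 0 (min x D)"
  assumes "1 \<le> min (min p q) e" "1 \<le> D"
  shows "f (min (min (p + 1) (q - 1)) e) + f (min (min (p - 1) (q + 1)) e)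
    \<le> 2 * f (min (min p q) e) - of_bool (min (min p q) e = D \<and> min p q \<le> e)"
proof -
  have mono: "f x \<le> f y" if "x \<le> y" for x y
    using that by (auto simp: f_def)
  have concave: "f (x + 1) + f (x - 1) \<le> 2 * f x - of_bool (x = D)" if "1 \<le> x" for x
    using that assms(3) by (auto simp: f_def of_bool_def)
  consider "min (min p q) e = e" "\<not> min p q \<le> e" | "min (min p q) e = p" | "min (min p q) e = q"
    by linarith
  then show ?thesis
  proof cases
    case 1
    have "f (min (min (p + 1) (q - 1)) e) \<le> f e" "f (min (min (p - 1) (q + 1)) e) \<le> f e"
      by (intro mono; linarith)+
    then show ?thesis
      using 1 by (auto simp: of_bool_def)
  next
    case 2
    have "f (min (min (p + 1) (q - 1)) e) \<le> f (p + 1)" "f (min (min (p - 1) (q + 1)) e) \<le> f (p - 1)"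
      by (intro mono; linarith)+
    then show ?thesis
      using 2 concave[of p] assms(2) by (auto simp: of_bool_def split: if_splits)
  next
    case 3
    have "f (min (min (p + 1) (q - 1)) e) \<le> f (q - 1)" "f (min (min (p - 1) (q + 1)) e) \<le> f (q + 1)"
      by (intro mono; linarith)+
    then show ?thesis
      using 3 concave[of q] assms(2) by (auto simp: of_bool_def split: if_splits)
  qed
qed

text \<open>The spare grain at depth exactly \<open>D\<close> is what pays for the grain that starts an avalanche.\<close>
lemma depth_superharmonic:
  fixes a b n D :: int
  defines "u \<equiv> \<lambda>w. max 0 (min (depth a b n w) D)"
  assumes "1 \<le> depth a b n w" "1 \<le> D"
  shows "nbr_sum u w \<le> 4 * u w - of_bool (depth a b n w = D)"
proof -
  obtain i j where w: "w = (i, j)" by (cases w)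
  define p q r s where "p = i - a + 1" and "q = a + n - i" and "r = j - b + 1" and "s = b + n - j"
  note defs = this
  have centre: "depth a b n (i, j) = min (min p q) (min r s)"
    and right: "depth a b n (i + 1, j) = min (min (p + 1) (q - 1)) (min r s)"
    and left: "depth a b n (i - 1, j) = min (min (p - 1) (q + 1)) (min r s)"
    and up: "depth a b n (i, j + 1) = min (min p q) (min (r + 1) (s - 1))"
    and down: "depth a b n (i, j - 1) = min (min p q) (min (r - 1) (s + 1))"
    by (simp_all add: depth_def defs algebra_simps)
  define X Y where "X \<longleftrightarrow> min p q \<le> min r s" and "Y \<longleftrightarrow> min r s \<le> min p q"
  have "u (i + 1, j) + u (i - 1, j) \<le> 2 * u (i, j) - of_bool (depth a b n w = D \<and> X)"
    using truncated_min_concave[of p q "min r s" D] assms(2,3)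
    unfolding u_def w centre right left X_def by blast
  moreover have "u (i, j + 1) + u (i, j - 1) \<le> 2 * u (i, j) - of_bool (depth a b n w = D \<and> Y)"
    using truncated_min_concave[of r s "min p q" D] assms(2,3)
    unfolding u_def w centre up down Y_def min.commute[of "min p q"] by blast
  moreover have "X \<or> Y" unfolding X_def Y_def by (rule linear)
  ultimately show ?thesis
    unfolding nbr_sum_def w fst_conv snd_conv by (auto simp: of_bool_def split: if_splits)
qed

text \<open>A vertex outside a square has at most one neighbour inside, and that neighbour has depth 1.\<close>
lemma nbr_sum_depth_outside:
  fixes a b n D :: int
  defines "u \<equiv> \<lambda>w. max 0 (min (depth a b n w) D)"
  assumes "depth a b n w \<le> 0" "1 \<le> D"
  shows "nbr_sum u w \<le> of_bool (\<exists>x. nbr w x \<and> 1 \<le> depth a b n x)"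
proof -
  obtain i j where w: "w = (i, j)" by (cases w)
  have zero: "u (x, z) \<le> 0" if "x < a \<or> a + n - 1 < x \<or> z < b \<or> b + n - 1 < z" for x z
  proof -
    have "depth a b n (x, z) \<le> 0" using that unfolding depth_def fst_conv snd_conv by linarith
    then show ?thesis by (simp add: u_def)
  qed
  have one: "u (x, z) \<le> 1" if "x \<le> a \<or> a + n - 1 \<le> x \<or> z \<le> b \<or> b + n - 1 \<le> z" for x z
  proof -
    have "depth a b n (x, z) \<le> 1" using that unfolding depth_def fst_conv snd_conv by linarith
    then show ?thesis by (simp add: u_def)
  qed
  consider "i < a" | "a + n - 1 < i" | "j < b" | "b + n - 1 < j"
    using assms(2) by (force simp: depth_def w)
  then have "nbr_sum u w \<le> 1"
  proof cases
    case 1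
    then show ?thesis
      using one[of "i + 1" j] zero[of "i - 1" j] zero[of i "j + 1"] zero[of i "j - 1"]
      by (simp add: nbr_sum_def w)
  next
    case 2
    then show ?thesis
      using zero[of "i + 1" j] one[of "i - 1" j] zero[of i "j + 1"] zero[of i "j - 1"]
      by (simp add: nbr_sum_def w)
  next
    case 3
    then show ?thesis
      using zero[of "i + 1" j] zero[of "i - 1" j] one[of i "j + 1"] zero[of i "j - 1"]
      by (simp add: nbr_sum_def w)
  next
    case 4
    then show ?thesis
      using zero[of "i + 1" j] zero[of "i - 1" j] zero[of i "j + 1"] one[of i "j - 1"]
      by (simp add: nbr_sum_def w)
  qed
  moreover have "nbr_sum u w = 0" if no: "\<not> (\<exists>x. nbr w x \<and> 1 \<le> depth a b n x)"
  proof -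
    have "u x = 0" if "nbr w x" for x
    proof -
      have "\<not> 1 \<le> depth a b n x" using that no by blast
      then show ?thesis by (simp add: u_def)
    qed
    then show ?thesis by (simp add: nbr_sum_def nbr_def w)
  qed
  ultimately show ?thesis by auto
qed

section \<open>Spreading through a punctured rectangle\<close>

lemma interval_propagate:
  fixes P :: "int \<Rightarrow> bool"
  assumes step: "\<And>t. p \<le> t \<Longrightarrow> t < q \<Longrightarrow> P t \<longleftrightarrow> P (t + 1)"
    and "s \<in> {p..q}" "t \<in> {p..q}"
  shows "P s \<longleftrightarrow> P t"
proof -
  have "P p \<longleftrightarrow> P t" if "p \<le> t" "t \<le> q" for t
    using that
  proof (induction t rule: int_ge_induct)
    case (step i)
    then show ?case using assms(1)[of i] by simp
  qed simp
  then show ?thesis using assms(2,3) by auto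
qed

text \<open>Deleting one vertex \<open>v\<close> from a rectangle with both sides at least 2 does not disconnect it:
  every remaining vertex lies on a row or a column that avoids \<open>v\<close>, and every such row meets every
  such column.\<close>
lemma punctured_rectangle_spread:
  fixes P :: "vertex \<Rightarrow> bool"
  assumes size: "p < q" "r < s"
    and y: "y \<in> {p..q} \<times> {r..s} - {v}" "P y"
    and spread: "\<And>x x'. x \<in> {p..q} \<times> {r..s} - {v} \<Longrightarrow> x' \<in> {p..q} \<times> {r..s} - {v} \<Longrightarrow>
      nbr x x' \<Longrightarrow> P x \<Longrightarrow> P x'"
    and w: "w \<in> {p..q} \<times> {r..s} - {v}"
  shows "P w"
proof -
  obtain v1 v2 where v: "v = (v1, v2)" by (cases v)
  have iff: "P x \<longleftrightarrow> P x'" if "x \<in> {p..q} \<times> {r..s} - {v}" "x' \<in> {p..q} \<times> {r..s} - {v}" "nbr x x'" for x x'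
    using spread that by (metis nbr_def abs_minus_commute)
  have row: "P (i, j) \<longleftrightarrow> P (i', j)"
    if "j \<noteq> v2" "j \<in> {r..s}" "i \<in> {p..q}" "i' \<in> {p..q}" for i i' j
  proof (rule interval_propagate[of p q "\<lambda>i. P (i, j)"])
    fix t assume "p \<le> t" "t < q"
    then show "P (t, j) \<longleftrightarrow> P (t + 1, j)" using that by (intro iff) (auto simp: v nbr_def)
  qed (use that in auto)
  have col: "P (i, j) \<longleftrightarrow> P (i, j')"
    if "i \<noteq> v1" "i \<in> {p..q}" "j \<in> {r..s}" "j' \<in> {r..s}" for i j j'
  proof (rule interval_propagate[of r s "\<lambda>j. P (i, j)"])
    fix t assume "r \<le> t" "t < s"
    then show "P (i, t) \<longleftrightarrow> P (i, t + 1)" using that by (intro iff) (auto simp: v nbr_def)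
  qed (use that in auto)
  obtain i0 where i0: "i0 \<in> {p..q}" "i0 \<noteq> v1"
    using size by (metis atLeastAtMost_iff less_le order_refl)
  obtain j0 where j0: "j0 \<in> {r..s}" "j0 \<noteq> v2"
    using size by (metis atLeastAtMost_iff less_le order_refl)
  have "P x \<longleftrightarrow> P (i0, j0)" if x: "x \<in> {p..q} \<times> {r..s} - {v}" for x
  proof -
    obtain i j where ij: "x = (i, j)" by (cases x)
    show ?thesis
    proof (cases "j = v2")
      case True
      then show ?thesis using x row[of j0 i i0] col[of i j j0] i0 j0 by (auto simp: ij v)
    next
      case False
      then show ?thesis using x row[of j i i0] col[of i0 j j0] i0 j0 by (auto simp: ij v)
    qed
  qed
  then show ?thesis using y w by blast
qed

section \<open>The odometer of a square with a central hole\<close>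

lemma nbr_cases:
  assumes "nbr w x"
  obtains "x = (fst w + 1, snd w)" | "x = (fst w - 1, snd w)"
    | "x = (fst w, snd w + 1)" | "x = (fst w, snd w - 1)"
proof -
  obtain i j i' j' where "w = (i, j)" "x = (i', j')" by (cases w; cases x)
  then show ?thesis using assms that by (simp add: nbr_def) arith
qed

lemma nbr_steps:
  "nbr w (fst w + 1, snd w)" "nbr w (fst w - 1, snd w)"
  "nbr w (fst w, snd w + 1)" "nbr w (fst w, snd w - 1)"
  by (auto simp: nbr_def)

lemma depth_nbr: "nbr w x \<Longrightarrow> depth a b n w - 1 \<le> depth a b n x"
  by (erule nbr_cases) (auto simp: depth_def)

lemma nbr_sum_ge:
  assumes "\<And>x. nbr w x \<Longrightarrow> k \<le> h x"
  shows "4 * k \<le> nbr_sum h w" and "nbr w x \<Longrightarrow> 3 * k + h x \<le> nbr_sum h w"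
proof -
  note ge = assms[OF nbr_steps(1)] assms[OF nbr_steps(2)] assms[OF nbr_steps(3)] assms[OF nbr_steps(4)]
  show "4 * k \<le> nbr_sum h w" using ge by (simp add: nbr_sum_def)
  show "nbr w x \<Longrightarrow> 3 * k + h x \<le> nbr_sum h w"
    by (erule nbr_cases) (use ge in \<open>simp_all add: nbr_sum_def\<close>)
qed

lemma depth_le: "2 * depth a b n w \<le> n + 1"
proof -
  have "depth a b n w \<le> fst w - a + 1" "depth a b n w \<le> a + n - fst w"
    by (simp_all add: depth_def)
  then show ?thesis by linarith
qed

text \<open>A square of critical vertices with side \<open>n\<close>, emptied at a vertex \<open>v\<close> of its innermost ring.
  The last assumption is what being a whole generator gives: a vertex next to the square is not
  critical, so it can absorb the one grain that it receives.\<close>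
locale holed_square =
  fixes L :: nat and a b n :: int and v :: vertex and \<zeta> :: sandpile
  assumes side: "2 \<le> n"
    and central: "n \<le> 2 * depth a b n v"
    and in_grid: "\<And>w. 1 \<le> depth a b n w \<Longrightarrow> w \<in> grid L"
    and critical: "\<And>w. 1 \<le> depth a b n w \<Longrightarrow> w \<noteq> v \<Longrightarrow> \<zeta> w = 3"
    and hole: "\<zeta> v = 0"
    and outside_nonneg: "\<And>w. w \<in> grid L \<Longrightarrow> depth a b n w \<le> 0 \<Longrightarrow> 0 \<le> \<zeta> w"
    and outside: "\<And>w. w \<in> grid L \<Longrightarrow> depth a b n w \<le> 0 \<Longrightarrow>
      \<zeta> w + of_bool (\<exists>x. nbr w x \<and> 1 \<le> depth a b n x) \<le> 3"
begin

abbreviation d :: "vertex \<Rightarrow> int" where "d \<equiv> depth a b n"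

text \<open>An avalanche started at \<open>y\<close> consists of waves. The \<open>k\<close>-th wave topples once each vertex of depth
  at least \<open>k\<close>; it leaves the values at depth greater than \<open>k\<close> as they were, and no vertex of
  depth \<open>k\<close> topples again, so the waves stop at \<open>k = d y\<close>. The hole takes part in a wave exactly if all of its
  neighbours do; it then receives and loses four grains. It fails to do so only in a wave on the
  central \<open>2 \<times> 2\<close> block, and this wave occurs exactly if \<open>2 * d y = n\<close>.\<close>
definition odometer :: "vertex \<Rightarrow> vertex \<Rightarrow> int" where
  "odometer y w = max 0 (min (d w) (d y)) - of_bool (w = v \<and> 2 * d y = n)"

lemma depth_hole: "1 \<le> d v" "d w \<le> d v"
  using side central depth_le[of a b n w] by linarith+

lemma even_centre:
  assumes "2 * d y = n" shows "d v = d y"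
  using assms central depth_le[of a b n v] by linarith

lemma add_grain_nonneg:
  assumes "1 \<le> d y" shows "\<forall>w\<in>grid L. 0 \<le> add_grain y \<zeta> w"
proof
  fix w assume "w \<in> grid L"
  then have "0 \<le> \<zeta> w"
    using outside_nonneg[of w] critical[of w] hole by (cases "d w \<le> 0"; cases "w = v") auto
  then show "0 \<le> add_grain y \<zeta> w" by (auto simp: add_grain_def)
qed

text \<open>Superharmonicity of the truncated depth bounds the grains at every vertex of the square by
  their initial number. At \<open>y\<close>, and at the hole if it skips the last wave, there is an excess to make up, but there the depth
  equals the cutoff \<open>d y\<close> and superharmonicity is strict.\<close>
lemma odometer_stabilizes:
  assumes y: "1 \<le> d y" "y \<noteq> v"
  shows "stabilizes L (add_grain y \<zeta>) (odometer y)"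
  unfolding stabilizes_def
proof (intro conjI allI ballI)
  fix w show "0 \<le> odometer y w"
    using y even_centre[of y] by (auto simp: odometer_def)
next
  fix w assume w: "w \<in> grid L"
  let ?u = "\<lambda>w. max 0 (min (d w) (d y))"
  have "nbr_sum (odometer y) w \<le> nbr_sum ?u w"
    by (simp add: nbr_sum_def odometer_def)
  moreover have "add_grain y \<zeta> w - 4 * odometer y w + nbr_sum ?u w \<le> 3"
  proof (cases "d w \<le> 0")
    case True
    then have "w \<noteq> v" "w \<noteq> y" using depth_hole y by auto
    then show ?thesis
      using nbr_sum_depth_outside[OF True y(1)] outside[OF w True] True
      by (simp add: odometer_def add_grain_def)
  next
    case False
    then have "nbr_sum ?u w \<le> 4 * ?u w - of_bool (d w = d y)"
      using depth_superharmonic[of a b n w "d y"] y by simp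
    then show ?thesis
      using y even_centre[of y] critical[of w] hole False
      by (cases "w = v"; cases "w = y") (auto simp: odometer_def add_grain_def of_bool_def split: if_splits)
  qed
  ultimately show "add_grain y \<zeta> w - 4 * odometer y w + nbr_sum (odometer y) w \<le> 3" by linarith
qed

text \<open>If a stabilizing \<open>h\<close> dominates the first \<open>k\<close> waves, then it dominates the next one. A vertex of
  depth greater than \<open>k\<close> that topples only \<open>k\<close> times has gained, from these \<open>k\<close> rounds, one grain per
  extra toppling of a neighbour. This forces an extra toppling at \<open>y\<close>, which has 4 grains from the
  start, and then at each critical vertex next to one that makes an extra toppling; so it spreads over
  the whole punctured square. The hole is forced too, as soon as all four of its neighbours lie
  in this square.\<close>
lemma next_wave:
  assumes y: "k + 1 \<le> d y" "y \<noteq> v" and k: "0 \<le> k"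
    and h: "stabilizes L (add_grain y \<zeta>) h"
    and full: "\<And>w. max 0 (min (d w) k) \<le> h w"
  shows "max 0 (min (d w) (k + 1)) - of_bool (w = v \<and> 2 * (k + 1) = n) \<le> h w"
proof -
  \<comment> \<open>The square of the next wave has side \<open>n - 2 * k\<close>. Side 1 would mean that \<open>y\<close> is the centre of
    an odd square, which is the hole.\<close>
  have n: "2 * k + 2 \<le> n"
  proof (rule ccontr)
    assume "\<not> 2 * k + 2 \<le> n"
    then have n: "n = 2 * k + 1" using y(1) depth_le[of a b n y] by linarith
    then have "k + 1 \<le> d v" using central by linarith
    then have "y = v" using y(1) n unfolding depth_ge_iff by auto
    then show False using y(2) by simp
  qed
  have ge: "k \<le> h x" if "k + 1 \<le> d w" "nbr w x" for w x
    using full[of x] depth_nbr[OF that(2), of a b n] that(1) by simp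
  have excess: "add_grain y \<zeta> w + (nbr_sum h w - 4 * k) \<le> 3" if "k + 1 \<le> d w" "h w \<le> k" for w
    using h that full[of w] in_grid[of w] k by (force simp: stabilizes_def)
  let ?S = "{a + k..a + n - (k + 1)} \<times> {b + k..b + n - (k + 1)}"
  have S: "x \<in> ?S \<longleftrightarrow> k + 1 \<le> d x" for x
    unfolding depth_ge_iff by (simp add: algebra_simps)
  have off_hole: "k + 1 \<le> h x" if "k + 1 \<le> d x" "x \<noteq> v" for x
  proof (rule punctured_rectangle_spread
      [of "a + k" "a + n - (k + 1)" "b + k" "b + n - (k + 1)" y v "\<lambda>x. k + 1 \<le> h x"])
    show "k + 1 \<le> h y"
    proof (rule ccontr)
      assume "\<not> k + 1 \<le> h y"
      then show False
        using excess[of y] nbr_sum_ge(1)[of y k h] ge[of y] y critical[of y] k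
        by (simp add: add_grain_def)
    qed
  next
    fix x x'
    assume "x \<in> ?S - {v}" and x': "x' \<in> ?S - {v}" and nb: "nbr x x'" and x: "k + 1 \<le> h x"
    have x'_deep: "k + 1 \<le> d x'" "x' \<noteq> v" using x' S by auto
    have nb': "nbr x' x" using nb by (simp add: nbr_def abs_minus_commute)
    show "k + 1 \<le> h x'"
    proof (rule ccontr)
      assume "\<not> k + 1 \<le> h x'"
      moreover have "3 \<le> add_grain y \<zeta> x'"
        using critical[of x'] x'_deep k by (auto simp: add_grain_def)
      ultimately show False
        using excess[of x'] nbr_sum_ge(2)[of x' k h x] ge[of x'] nb' x x'_deep by fastforce
    qed
  qed (use that y n S in auto)
  consider "d w \<le> k" | "k + 1 \<le> d w" "w \<noteq> v" | "w = v" "2 * (k + 1) = n"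
    | "w = v" "2 * k + 3 \<le> n"
    using n by (cases "w = v"; cases "d w \<le> k") (auto dest: le_imp_less_or_eq)
  then show ?thesis
  proof cases
    case 1
    then have "max 0 (min (d w) (k + 1)) \<le> h w" using full[of w] by simp
    then show ?thesis by (rule order_trans[rotated]) simp
  next
    case 2
    then show ?thesis using off_hole[of w] k by simp
  next
    case 3
    then show ?thesis using full[of v] central k by simp
  next
    case 4
    have deep: "k + 2 \<le> d v" using 4 central by linarith
    have "k + 1 \<le> h x" if "nbr v x" for x
      using off_hole[of x] depth_nbr[OF that, of a b n] deep that by force
    then have "4 * (k + 1) \<le> nbr_sum h v" by (rule nbr_sum_ge(1))
    then have "k + 1 \<le> h v"
      using excess[of v] deep hole y(2) by (force simp: add_grain_def)
    then show ?thesis using 4 k by simp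
  qed
qed

lemma odometer_least:
  assumes y: "1 \<le> d y" "y \<noteq> v"
    and h: "stabilizes L (add_grain y \<zeta>) h"
  shows "odometer y w \<le> h w"
proof -
  have "int k \<le> d y \<Longrightarrow> max 0 (min (d w) (int k)) - of_bool (w = v \<and> 2 * int k = n) \<le> h w" for k w
  proof (induction k arbitrary: w)
    case 0
    have "0 \<le> h w" using h unfolding stabilizes_def by blast
    then show ?case using side by simp
  next
    case (Suc k)
    have "2 * int k \<noteq> n" using Suc.prems depth_le[of a b n y] by simp
    then have "max 0 (min (d x) (int k)) \<le> h x" for x using Suc.IH[of x] Suc.prems by simp
    then show ?case
      using next_wave[of "int k" y h w] Suc.prems y h by (simp add: add.commute)
  qed
  from this[of "nat (d y)" w] show ?thesis using y by (simp add: odometer_def)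
qed

lemma avalanche_size_hole: "avalanche_size L \<zeta> v = 0"
proof -
  have "stabilizes L (add_grain v \<zeta>) (\<lambda>_. 0)"
    unfolding stabilizes_def
  proof (intro conjI allI ballI)
    fix w assume "w \<in> grid L"
    then have "\<zeta> w \<le> 3" if "d w \<le> 0"
      using outside[of w] that by (simp add: of_bool_def split: if_splits)
    then have "add_grain v \<zeta> w \<le> 3"
      using critical[of w] hole by (cases "w = v"; cases "d w \<le> 0") (auto simp: add_grain_def)
    then show "add_grain v \<zeta> w - 4 * 0 + nbr_sum (\<lambda>_. 0) w \<le> 3" by (simp add: nbr_sum_def)
  qed simp
  then have "int (avalanche_size L \<zeta> v) = (\<Sum>w\<in>grid L. 0)"
  proof (intro avalanche_size_eq_sum add_grain_nonneg depth_hole)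
    fix h w assume "stabilizes L (add_grain v \<zeta>) h"
    then show "0 \<le> h w" unfolding stabilizes_def by blast
  qed
  then show ?thesis by simp
qed

lemma avalanche_size_square:
  assumes y: "1 \<le> d y" "y \<noteq> v"
  shows "int (avalanche_size L \<zeta> y) = (\<Sum>w | 1 \<le> d w. min (d w) (d y)) - of_bool (2 * d y = n)"
proof -
  have sub: "{w. 1 \<le> d w} \<subseteq> grid L" using in_grid by auto
  have "int (avalanche_size L \<zeta> y) = (\<Sum>w\<in>grid L. odometer y w)"
    by (rule avalanche_size_eq_sum) (fact add_grain_nonneg[OF y(1)] odometer_stabilizes[OF y] odometer_least[OF y])+
  also have "\<dots> = (\<Sum>w | 1 \<le> d w. odometer y w)"
    using depth_hole by (intro sum.mono_neutral_right sub) (auto simp: odometer_def)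
  also have "\<dots> = (\<Sum>w | 1 \<le> d w. min (d w) (d y) - of_bool (2 * d y = n) * of_bool (w = v))"
    using y by (intro sum.cong) (auto simp: odometer_def)
  also have "\<dots> = (\<Sum>w | 1 \<le> d w. min (d w) (d y)) - of_bool (2 * d y = n)"
    using depth_hole finite_subset[OF sub] by (simp add: sum_subtractf flip: sum_distrib_left)
  finally show ?thesis .
qed

end

section \<open>Rings and generators\<close>

lemma square_eq_depth: "{a..<a + n} \<times> {b..<b + n} = {w. 1 \<le> depth a b n w}"
  unfolding depth_ge_iff by auto

lemma outside_nbrs_rectangle:
  assumes "p < q" "r < s" "(i, j) \<in> {p..q} \<times> {r..s}"
  shows "card (outside_nbrs ({p..q} \<times> {r..s}) (i, j))
    = of_bool (i = p) + of_bool (i = q) + of_bool (j = r) + of_bool (j = s)"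
proof -
  have "outside_nbrs ({p..q} \<times> {r..s}) (i, j) =
      (if i = p then {(i - 1, j)} else {}) \<union> (if i = q then {(i + 1, j)} else {}) \<union>
      ((if j = r then {(i, j - 1)} else {}) \<union> (if j = s then {(i, j + 1)} else {}))"
    (is "?lhs = ?rhs")
  proof (intro equalityI subsetI)
    fix x assume "x \<in> ?lhs"
    then have "nbr (i, j) x" "x \<notin> {p..q} \<times> {r..s}" by (auto simp: outside_nbrs_def)
    then show "x \<in> ?rhs"
      by (cases rule: nbr_cases[of "(i, j)" x]) (use assms in auto)
  next
    fix x assume "x \<in> ?rhs"
    then show "x \<in> ?lhs"
      using assms by (auto simp: outside_nbrs_def nbr_def split: if_splits)
  qed
  then show ?thesis using assms by auto
qed

text \<open>A vertex \<open>v\<close> deeper than \<open>k\<close> makes the side of the layer at least 3. Opposite sides are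
  then distinct, so that a boundary vertex has one outside neighbour or, at a corner, two.\<close>
lemma boundary_layer:
  assumes "k < depth a b n v"
  shows "inner_boundary {w. k \<le> depth a b n w} \<union> corners {w. k \<le> depth a b n w}
    = {w. depth a b n w = k}"
proof -
  let ?p = "a + k - 1" and ?q = "a + n - k" and ?r = "b + k - 1" and ?s = "b + n - k"
  have S: "{w. k \<le> depth a b n w} = {?p..?q} \<times> {?r..?s}"
    unfolding depth_ge_iff by auto
  have size: "?p < ?q" "?r < ?s"
    using assms unfolding depth_def by linarith+
  have "w \<in> inner_boundary ({?p..?q} \<times> {?r..?s}) \<union> corners ({?p..?q} \<times> {?r..?s})
      \<longleftrightarrow> depth a b n w = k" for w
  proof (cases "k \<le> depth a b n w")
    case True
    obtain i j where w: "w = (i, j)" by (cases w)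
    have mem: "(i, j) \<in> {?p..?q} \<times> {?r..?s}" using True[unfolded depth_ge_iff] w by simp
    have "depth a b n w = k \<longleftrightarrow> i = ?p \<or> i = ?q \<or> j = ?r \<or> j = ?s"
      using True unfolding w depth_def fst_conv snd_conv by linarith
    then show ?thesis
      using outside_nbrs_rectangle[OF size mem] mem size
      by (auto simp: inner_boundary_def corners_def w of_bool_def split: if_splits)
  next
    case False
    then show ?thesis using S by (auto simp: inner_boundary_def corners_def)
  qed
  then show ?thesis unfolding S by blast
qed

text \<open>Rings are numbered from the inside and depth from the outside, whence \<open>m + 1 - j\<close>; removing
  the rings outside the \<open>j\<close>-th one leaves a concentric square.\<close>
lemma square_ring_eq_layer:
  fixes N :: nat and a b :: int
  defines "A \<equiv> {a..<a + int N} \<times> {b..<b + int N}" and "m \<equiv> nat \<lceil>real N / 2\<rceil>"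
  assumes "1 \<le> j" "j \<le> m"
  shows "square_ring N A j = {w. depth a b (int N) w = int m + 1 - int j}"
  using assms(3,4)
proof (induction "m - j" arbitrary: j rule: less_induct)
  case less
  have m: "2 * int m = int N \<or> 2 * int m = int N + 1"
    unfolding m_def by linarith
  let ?d = "depth a b (int N)"
  have "A - (\<Union>k\<in>{j + 1..m}. square_ring N A k) = A - (\<Union>k\<in>{j + 1..m}. {w. ?d w = int m + 1 - int k})"
    using less by (intro arg_cong2[of _ _ _ _ "(-)"] refl SUP_cong) auto
  also have "\<dots> = {w. int m + 1 - int j \<le> ?d w}"
  proof -
    have "w \<in> (\<Union>k\<in>{j + 1..m}. {w. ?d w = int m + 1 - int k}) \<longleftrightarrow>
        1 \<le> ?d w \<and> ?d w < int m + 1 - int j" for w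
    proof
      assume "1 \<le> ?d w \<and> ?d w < int m + 1 - int j"
      then show "w \<in> (\<Union>k\<in>{j + 1..m}. {w. ?d w = int m + 1 - int k})"
        by (intro UN_I[of "nat (int m + 1 - ?d w)"]) auto
    qed auto
    then show ?thesis using less.prems unfolding A_def square_eq_depth by auto
  qed
  finally have rest: "A - (\<Union>k\<in>{j + 1..m}. square_ring N A k) = {w. int m + 1 - int j \<le> ?d w}" .
  show ?case
  proof (cases "j = 1")
    case True
    have "?d w \<le> int m" for w using depth_le[of a b "int N" w] m by linarith
    then show ?thesis
      using rest True by (subst square_ring.simps) (auto simp: m_def Let_def intro: antisym)
  next
    case False
    have "int m \<le> ?d (a + int m - 1, b + int m - 1)"
      using m unfolding depth_ge_iff by auto
    then have "int m + 1 - int j < ?d (a + int m - 1, b + int m - 1)"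
      using False less.prems by linarith
    from boundary_layer[OF this] show ?thesis
      using rest False less.prems by (subst square_ring.simps) (simp add: m_def Let_def)
  qed
qed

text \<open>Otherwise \<open>w\<close> would be critical and could be added to \<open>A\<close>, against maximality.\<close>
lemma generator_adjacent:
  assumes gen: "generator L \<eta> A" and \<eta>: "\<eta> \<in> stable_sandpiles L"
    and w: "w \<in> grid L" "w \<notin> A" and x: "x \<in> A" "nbr w x"
  shows "\<eta> w \<le> 2"
proof (rule ccontr)
  assume "\<not> \<eta> w \<le> 2"
  then have crit: "w \<in> critical L \<eta>"
    using \<eta> w by (force simp: critical_def stable_sandpiles_def)
  have A: "nbr_connected A" "A \<subseteq> critical L \<eta>"
    and max: "\<And>B. nbr_connected B \<Longrightarrow> B \<subseteq> critical L \<eta> \<Longrightarrow> A \<subseteq> B \<Longrightarrow> B = A"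
    using gen unfolding generator_def by blast+
  let ?E = "\<lambda>S. {(s, t). s \<in> S \<and> t \<in> S \<and> nbr s t}"
  have "(?E A)\<^sup>* \<subseteq> (?E (insert w A))\<^sup>*" by (rule rtrancl_mono) auto
  then have AA: "(s, t) \<in> (?E (insert w A))\<^sup>*" if "s \<in> A" "t \<in> A" for s t
    using A(1) that unfolding nbr_connected_def by blast
  have wx: "(w, x) \<in> (?E (insert w A))\<^sup>*" "(x, w) \<in> (?E (insert w A))\<^sup>*"
    using x by (auto intro!: r_into_rtrancl simp: nbr_def abs_minus_commute)
  have "nbr_connected (insert w A)"
    unfolding nbr_connected_def
  proof (intro conjI ballI)
    fix s t assume "s \<in> insert w A" "t \<in> insert w A"
    then have "(s, x) \<in> (?E (insert w A))\<^sup>*" "(x, t) \<in> (?E (insert w A))\<^sup>*"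
      using AA wx x(1) by blast+
    then show "(s, t) \<in> (?E (insert w A))\<^sup>*" by (rule rtrancl_trans)
  qed simp
  then have "insert w A = A" using max[of "insert w A"] A(2) crit by auto
  then show False using w by auto
qed

section \<open>Summing the avalanche sizes\<close>

lemma count_layers:
  assumes "0 \<le> z" "z \<le> int m"
  shows "(\<Sum>j<m. of_bool (int m - int j \<le> z)) = z"
proof -
  have "(\<Sum>j<m. of_bool (int m - int j \<le> z)) = int (card {j. j < m \<and> int m - int j \<le> z})"
    by (simp add: of_bool_def sum.If_cases Int_def)
  also have "{j. j < m \<and> int m - int j \<le> z} = {nat (int m - z)..<m}"
    using assms by auto
  also have "int (card \<dots>) = z" using assms by simp
  finally show ?thesis .
qed

text \<open>The depth of a vertex counts the concentric squares containing it, and the minimum of two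
  depths counts those containing both vertices. Exchanging sums, each square contributes the square of
  its area \<open>c j\<close> to the double sum and \<open>c j\<close> to the single one. The innermost square, of side
  1 or 2, has index \<open>j = 0\<close>.\<close>
lemma sum_depth_min:
  fixes m :: nat and c :: "nat \<Rightarrow> int" and n :: int
  defines "c \<equiv> \<lambda>j. (n - 2 * int m + 2 * int j + 2)^2"
  assumes m: "2 * int m = n \<or> 2 * int m = n + 1"
  shows "(\<Sum>y | 1 \<le> depth a b n y. \<Sum>w | 1 \<le> depth a b n w. min (depth a b n w) (depth a b n y))
      = (\<Sum>j<m. (c j)^2)"
    and "(\<Sum>w | 1 \<le> depth a b n w. depth a b n w) = (\<Sum>j<m. c j)"
proof -
  let ?d = "depth a b n" and ?A = "{w. 1 \<le> depth a b n w}"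
  let ?I = "\<lambda>j w. of_bool (int m - int j \<le> ?d w) :: int"
  have fin: "finite ?A" unfolding square_eq_depth[symmetric] by simp
  have le: "?d w \<le> int m" for w using depth_le[of a b n w] m by linarith
  have layer: "(\<Sum>w\<in>?A. ?I j w) = c j" if "j < m" for j
  proof -
    have "(\<Sum>w\<in>?A. ?I j w) = int (card (?A \<inter> {w. int m - int j \<le> ?d w}))"
      using fin by (simp add: of_bool_def sum.If_cases)
    also have "?A \<inter> {w. int m - int j \<le> ?d w} = {w. int m - int j \<le> ?d w}"
      using that by auto
    also have "\<dots> = {a + (int m - int j) - 1..a + n - (int m - int j)} \<times>
        {b + (int m - int j) - 1..b + n - (int m - int j)}"
      unfolding depth_ge_iff by auto
    also have "int (card \<dots>) = c j"
      using that m unfolding c_def by (auto simp: card_cartesian_product power2_eq_square algebra_simps)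
    finally show ?thesis .
  qed
  have min_eq: "min (?d w) (?d y) = (\<Sum>j<m. ?I j w * ?I j y)" if "w \<in> ?A" "y \<in> ?A" for w y
    using that le[of w] count_layers[of "min (?d w) (?d y)" m] by (simp flip: of_bool_conj)
  have "(\<Sum>y\<in>?A. \<Sum>w\<in>?A. min (?d w) (?d y)) = (\<Sum>y\<in>?A. \<Sum>w\<in>?A. \<Sum>j<m. ?I j w * ?I j y)"
    by (intro sum.cong refl min_eq)
  also have "\<dots> = (\<Sum>j<m. \<Sum>y\<in>?A. \<Sum>w\<in>?A. ?I j w * ?I j y)"
    by (subst sum.swap[of _ "{..<m}"], subst sum.swap[of _ _ "{..<m}"]) (rule refl)
  also have "\<dots> = (\<Sum>j<m. (\<Sum>y\<in>?A. ?I j y)^2)"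
    by (simp only: power2_eq_square sum_product mult.commute)
  also have "\<dots> = (\<Sum>j<m. (c j)^2)"
    by (intro sum.cong refl) (simp only: lessThan_iff layer)
  finally show "(\<Sum>y\<in>?A. \<Sum>w\<in>?A. min (?d w) (?d y)) = (\<Sum>j<m. (c j)^2)" .
  have "(\<Sum>w\<in>?A. ?d w) = (\<Sum>w\<in>?A. \<Sum>j<m. ?I j w)"
    by (intro sum.cong refl count_layers[symmetric]) (use le in auto)
  also have "\<dots> = (\<Sum>j<m. c j)"
    by (subst sum.swap) (intro sum.cong refl, simp only: lessThan_iff layer)
  finally show "(\<Sum>w\<in>?A. ?d w) = (\<Sum>j<m. c j)" .
qed

lemma sum_even_powers:
  "15 * (\<Sum>j<m. ((2 * int j + 2)^2)^2) = 8 * int m * (int m + 1) * (2 * int m + 1) * (3 * (int m)^2 + 3 * int m - 1)"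
  "3 * (\<Sum>j<m. (2 * int j + 2)^2) = 2 * int m * (int m + 1) * (2 * int m + 1)"
  by (induction m) (auto simp: algebra_simps power2_eq_square)

lemma sum_odd_powers:
  "15 * (\<Sum>j<m. ((2 * int j + 1)^2)^2) = int m * (4 * (int m)^2 - 1) * (12 * (int m)^2 - 7)"
  "3 * (\<Sum>j<m. (2 * int j + 1)^2) = int m * (4 * (int m)^2 - 1)"
  by (induction m) (auto simp: algebra_simps power2_eq_square)

context holed_square
begin

text \<open>The first sum would be the total if every start \<open>y\<close> caused all of its waves in full. The start
  \<open>y = v\<close> causes no toppling, which takes away the second sum; and if \<open>n\<close> is even, the three other
  vertices of the central block each lose the one toppling of the hole.\<close>
lemma sum_avalanche_sizes:
  assumes m: "2 * int m = n \<or> 2 * int m = n + 1"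
  shows "(\<Sum>y | 1 \<le> d y. int (avalanche_size L \<zeta> y)) =
    (\<Sum>j<m. ((n - 2 * int m + 2 * int j + 2)^2)^2) - (\<Sum>j<m. (n - 2 * int m + 2 * int j + 2)^2)
      - 3 * of_bool (even n)"
proof -
  let ?A = "{w. 1 \<le> d w}"
  have fin: "finite ?A" unfolding square_eq_depth[symmetric] by simp
  have vA: "v \<in> ?A" using depth_hole by simp
  have central_count: "(\<Sum>y\<in>?A - {v}. of_bool (2 * d y = n)) = 3 * (of_bool (even n) :: int)"
  proof (cases "even n")
    case True
    then have n: "n = 2 * int m" using m by presburger
    have "2 * z = n \<longleftrightarrow> int m \<le> z" if "2 * z \<le> n + 1" for z
      using that n by presburger
    then have "2 * d y = n \<longleftrightarrow> int m \<le> d y" for y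
      using depth_le by blast
    then have eq: "{y. 2 * d y = n} = {a + int m - 1..a + int m} \<times> {b + int m - 1..b + int m}"
      unfolding depth_ge_iff by (auto simp: n)
    have "(\<Sum>y\<in>?A - {v}. of_bool (2 * d y = n)) = int (card ((?A - {v}) \<inter> {y. 2 * d y = n}))"
      using fin by (simp add: of_bool_def sum.If_cases)
    also have "(?A - {v}) \<inter> {y. 2 * d y = n} = {y. 2 * d y = n} - {v}"
      using side by auto
    also have "int (card \<dots>) = int (card {y. 2 * d y = n}) - 1"
    proof -
      have "v \<in> {y. 2 * d y = n}" using central depth_le[of a b n v] n by simp
      moreover have "finite {y. 2 * d y = n}" unfolding eq by simp
      ultimately show ?thesis
        using card.remove[of "{y. 2 * d y = n}" v] by linarith
    qed
    also have "\<dots> = 3" unfolding eq by (simp add: card_cartesian_product)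
    finally show ?thesis using True by simp
  next
    case False
    then have "2 * d y \<noteq> n" for y by (metis dvd_triv_left)
    then show ?thesis using False by simp
  qed
  have "(\<Sum>y\<in>?A. int (avalanche_size L \<zeta> y)) = (\<Sum>y\<in>?A - {v}. int (avalanche_size L \<zeta> y))"
    using avalanche_size_hole by (intro sum.mono_neutral_right fin) auto
  also have "\<dots> = (\<Sum>y\<in>?A - {v}. (\<Sum>w\<in>?A. min (d w) (d y)) - of_bool (2 * d y = n))"
    by (intro sum.cong refl avalanche_size_square) auto
  also have "\<dots> = (\<Sum>y\<in>?A. \<Sum>w\<in>?A. min (d w) (d y)) - (\<Sum>w\<in>?A. min (d w) (d v))
      - 3 * of_bool (even n)"
    using fin vA central_count by (simp add: sum_subtractf sum_diff1)
  also have "(\<Sum>w\<in>?A. min (d w) (d v)) = (\<Sum>w\<in>?A. d w)"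
    by (intro sum.cong refl min_absorb1 depth_hole)
  finally show ?thesis using sum_depth_min[OF m] by simp
qed

end

section \<open>The expected avalanche size\<close>

theorem lemma4p3:
  fixes L N :: nat and \<eta> :: sandpile and A :: "vertex set" and v :: vertex
  assumes "L \<ge> 1" and "N \<ge> 2"
    and "\<eta> \<in> stable_sandpiles L"
    and "generator L \<eta> A"
    and "square_of_side N A"
    and "v \<in> square_ring N A 1"
  shows "expected_avalanche L (remove_grains v \<eta>) A =
    (if odd N
     then ((real N)^2 - 1) * ((real N)^2 + 5 * real N + 6) / (10 * real N)
     else ((real N)^5 + 5 * (real N)^4 + 5 * (real N)^3 - 5 * (real N)^2 - 6 * real N - 30)
          / (10 * (real N)^2))"
proof -
  obtain a b where A: "A = {a..<a + int N} \<times> {b..<b + int N}"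
    using assms(5) unfolding square_of_side_def by blast
  note A_depth = A[unfolded square_eq_depth]
  define m where "m = nat \<lceil>real N / 2\<rceil>"
  have m: "2 * int m = int N \<or> 2 * int m = int N + 1"
    unfolding m_def by linarith
  have one_le: "1 \<le> m" using m assms(2) by linarith
  have "square_ring N A 1 = {w. depth a b (int N) w = int m}"
    using square_ring_eq_layer[of 1 N a b] one_le unfolding A m_def[symmetric] by simp
  then have v: "depth a b (int N) v = int m" using assms(6) by auto
  have crit: "A \<subseteq> critical L \<eta>" using assms(4) unfolding generator_def by blast
  interpret holed_square L a b "int N" v "remove_grains v \<eta>"
  proof
    show "2 \<le> int N" using assms(2) by simp
    show "int N \<le> 2 * depth a b (int N) v" using v m by linarith
    show "remove_grains v \<eta> v = 0" by (simp add: remove_grains_def)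
  next
    fix w assume "1 \<le> depth a b (int N) w"
    then have "w \<in> critical L \<eta>" using crit A_depth by auto
    then show "w \<in> grid L" "w \<noteq> v \<Longrightarrow> remove_grains v \<eta> w = 3"
      by (auto simp: critical_def remove_grains_def)
  next
    fix w assume w: "w \<in> grid L" "depth a b (int N) w \<le> 0"
    then have wv: "w \<noteq> v" "w \<notin> A" using v m assms(2) A_depth by auto
    have stable: "0 \<le> \<eta> w" "\<eta> w < 4" using w assms(3) by (auto simp: stable_sandpiles_def)
    show "0 \<le> remove_grains v \<eta> w" using wv stable by (simp add: remove_grains_def)
    show "remove_grains v \<eta> w + of_bool (\<exists>x. nbr w x \<and> 1 \<le> depth a b (int N) x) \<le> 3"
    proof (cases "\<exists>x. nbr w x \<and> 1 \<le> depth a b (int N) x")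
      case True
      then obtain x where "nbr w x" "x \<in> A" using A_depth by blast
      then have "\<eta> w \<le> 2" using generator_adjacent assms(3,4) w(1) wv(2) by blast
      then show ?thesis using wv by (simp add: remove_grains_def)
    next
      case False
      then have "of_bool (\<exists>x. nbr w x \<and> 1 \<le> depth a b (int N) x) = (0 :: int)"
        by (rule of_bool_eq_0_iff[THEN iffD2])
      then show ?thesis using wv stable by (simp only: remove_grains_def) simp
    qed
  qed
  let ?T = "\<Sum>y\<in>A. int (avalanche_size L (remove_grains v \<eta>) y)"
  have "v \<in> A" using A_depth depth_hole by simp
  then have "A \<noteq> {}" by blast
  moreover have "A \<subseteq> grid L" using A_depth in_grid by auto
  moreover have "real (card A) = (real N)^2"
    unfolding A by (simp add: card_cartesian_product power2_eq_square)
  ultimately have E: "expected_avalanche L (remove_grains v \<eta>) A = of_int ?T / (real N)^2"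
    by (simp add: expected_avalanche_eq_average)
  show ?thesis
  proof (cases "odd N")
    case True
    then have N: "int N = 2 * int m - 1" using m by presburger
    have "15 * ?T = int m * (4 * (int m)^2 - 1) * (12 * (int m)^2 - 12)"
      using sum_avalanche_sizes[OF m] sum_odd_powers[of m] True
      unfolding A_depth by (simp add: N algebra_simps)
    then have "real_of_int (15 * ?T) = real_of_int (int m * (4 * (int m)^2 - 1) * (12 * (int m)^2 - 12))"
      by (simp only:)
    moreover have side: "real N = 2 * real m - 1" using N by linarith
    ultimately have total:
      "10 * real_of_int ?T = real N * (((real N)^2 - 1) * ((real N)^2 + 5 * real N + 6))"
      unfolding side by (simp add: algebra_simps power2_eq_square)
    have "t / x^2 = p / (10 * x)" if "10 * t = x * p" "x \<noteq> 0" for t x p :: real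
    proof -
      have "t = x * p / 10" using that(1) by simp
      show ?thesis unfolding \<open>t = _\<close> using that(2) by (simp add: power2_eq_square)
    qed
    from this[OF total] show ?thesis using True assms(2) unfolding E by simp
  next
    case False
    then have N: "int N = 2 * int m" using m by presburger
    have "15 * ?T = 8 * int m * (int m + 1) * (2 * int m + 1) * (3 * (int m)^2 + 3 * int m - 1)
        - 10 * int m * (int m + 1) * (2 * int m + 1) - 45"
      using sum_avalanche_sizes[OF m] sum_even_powers[of m] False
      unfolding A_depth by (simp add: N algebra_simps)
    then have "real_of_int (15 * ?T) = real_of_int (8 * int m * (int m + 1) * (2 * int m + 1)
        * (3 * (int m)^2 + 3 * int m - 1) - 10 * int m * (int m + 1) * (2 * int m + 1) - 45)"
      by (simp only:)
    moreover have "real N = 2 * real m" using N by linarith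
    ultimately show ?thesis using False assms(2) unfolding E
      by (simp add: field_simps power2_eq_square power3_eq_cube numeral_eq_Suc)
  qed
qed

end
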